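(* Let $k$ be a positive integer. Let $A_k$ be the set of integer partitions in which no part appears more than $2k-1$ times, let $B_k$ be the set of integer partitions with initial $k$-repetitions, and let $\Phi_k:A_k\to B_k$ be the map defined by the construction described in the context ($\lambda \mapsto \lambda' \mapsto (\pi,\delta) \mapsto \alpha=\pi+\delta \mapsto \alpha'$). Then the inverse of $\Phi_k$ is well-defined on $B_k$: for every $\beta\in B_k$ there is exactly one $\lambda\in A_k$ with $\Phi_k(\lambda)=\beta$.
   Context: A partition $\lambda=(\lambda_1\ge\lambda_2\ge\cdots\ge\lambda_m>0)$ is a finite weakly decreasing sequence of positive integers (possibly empty), with the convention $\lambda_i=0$ for $i>m$. Its conjugate $\lambda'$ is the partition with $\lambda'_i=\#\{j:\lambda_j\ge i\}$. A partition has initial $k$-repetitions if, whenever a part $j$ appears at least $k$ times, every positive integer less than $j$ also appears at least $k$ times as a part. $k$-strips: if $\lambda_i-\lambda_{i+1}\ge k$ (where $1\le i\le m$ and $\lambda_{m+1}=0$), one may subtract $k$ from each of the parts $\lambda_1,\dots,\lambda_i$ and still have a partition; this is called removing a $k$-strip of length $i$ (of total size $ki$). Removing all $k$-strips until none can be removed (the result does not depend on the order) decomposes $\lambda$ as a pair $(\pi,\delta)$. Here $\delta$ is the partition into multiples of $k$ recording the total amounts removed in the strips, i.e. the part $ki$ occurs in $\delta$ exactly $\lfloor(\lambda_i-\lambda_{i+1})/k\rfloor$ times. The partition $\pi$ is what remains; it is $k$-flat, meaning that $\pi_i-\pi_{i+1}<k$ for all $i\ge1$ (so in particular its smallest part is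 less than $k$). The map $\Phi_k$: given a partition $\lambda$ in which no part appears more than $2k-1$ times, (1) form the conjugate $\lambda'$; (2) remove all $k$-strips from $\lambda'$ to obtain the pair $(\pi,\delta)$, where $\delta$ is the partition in which the part $ki$ occurs exactly $\lfloor(\lambda'_i-\lambda'_{i+1})/k\rfloor$ times for each $i\ge1$ and $\pi$ is the $k$-flat partition that remains of $\lambda'$; (3) form $\alpha=\pi+\delta$ by $\alpha_i=\pi_i+\delta_i$ for all $i$, with the shorter of $\pi,\delta$ padded by zeros; (4) set $\Phi_k(\lambda)=\alpha'$, the conjugate of $\alpha$. The image $\Phi_k(\lambda)$ is always a partition with initial $k$-repetitions, so $\Phi_k$ is a map $A_k\to B_k$. *)

theory Defs
  imports "HOL-Library.Multiset"
begin

definition is_partition :: "nat list \<Rightarrow> bool" where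
  "is_partition xs \<longleftrightarrow> sorted_wrt (\<ge>) xs \<and> 0 \<notin> set xs"

text \<open>Parts are indexed from 1, and \<open>part xs i = 0\<close> beyond the length.\<close>

definition part :: "nat list \<Rightarrow> nat \<Rightarrow> nat" where
  "part xs i = (if 1 \<le> i \<and> i \<le> length xs then xs ! (i - 1) else 0)"

text \<open>The partition with parts \<open>f 1 \<ge> f 2 \<ge> \<dots> \<ge> f n\<close>, without the trailing zeros.\<close>

definition of_parts :: "(nat \<Rightarrow> nat) \<Rightarrow> nat \<Rightarrow> nat list" where
  "of_parts f n = filter (\<lambda>x. 0 < x) (map f [1..<Suc n])"

definition conjugate :: "nat list \<Rightarrow> nat list" where
  "conjugate xs = of_parts (\<lambda>i. card {j. 1 \<le> j \<and> i \<le> part xs j}) (part xs 1)"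

definition part_add :: "nat list \<Rightarrow> nat list \<Rightarrow> nat list" where
  "part_add xs ys = of_parts (\<lambda>i. part xs i + part ys i) (max (length xs) (length ys))"

definition initial_repetitions :: "nat \<Rightarrow> nat list \<Rightarrow> bool" where
  "initial_repetitions k xs \<longleftrightarrow>
     (\<forall>j. j \<in> set xs \<and> k \<le> count_list xs j \<longrightarrow> (\<forall>i. 0 < i \<and> i < j \<longrightarrow> k \<le> count_list xs i))"

definition k_flat :: "nat \<Rightarrow> nat list \<Rightarrow> bool" where
  "k_flat k xs \<longleftrightarrow> (\<forall>i\<ge>1. part xs i - part xs (i + 1) < k)"

definition strip_count :: "nat \<Rightarrow> nat list \<Rightarrow> nat \<Rightarrow> nat" where
  "strip_count k xs i = (part xs i - part xs (i + 1)) div k"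

definition strips :: "nat \<Rightarrow> nat list \<Rightarrow> nat list" where
  "strips k xs = concat (map (\<lambda>i. replicate (strip_count k xs i) (k * i)) (rev [1..<Suc (length xs)]))"

text \<open>A strip of length \<open>j\<close> takes \<open>k\<close> away from part \<open>i\<close> iff \<open>i \<le> j\<close>.  That
  \<open>strips\<close> and \<open>flat_part\<close> are the outcome of removing strips one at a time, in any
  order, is proved below (\<open>strip_removal_exists\<close>, \<open>strip_removal_unique\<close>).\<close>

definition flat_part :: "nat \<Rightarrow> nat list \<Rightarrow> nat list" where
  "flat_part k xs =
     of_parts (\<lambda>i. part xs i - k * (\<Sum>j = i..length xs. strip_count k xs j)) (length xs)"

definition remove_strip :: "nat \<Rightarrow> nat \<Rightarrow> nat list \<Rightarrow> nat list" where
  "remove_strip k i xs = of_parts (\<lambda>j. part xs j - (if j \<le> i then k else 0)) (length xs)"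

text \<open>One removal, with the total amounts removed so far recorded in the second component.\<close>

inductive strip_step :: "nat \<Rightarrow> nat list \<times> nat multiset \<Rightarrow> nat list \<times> nat multiset \<Rightarrow> bool"
  for k where
  "1 \<le> i \<Longrightarrow> i \<le> length xs \<Longrightarrow> k \<le> part xs i - part xs (i + 1) \<Longrightarrow>
     strip_step k (xs, D) (remove_strip k i xs, add_mset (k * i) D)"

definition A_set :: "nat \<Rightarrow> nat list set" where
  "A_set k = {xs. is_partition xs \<and> (\<forall>j. count_list xs j \<le> 2 * k - 1)}"

definition B_set :: "nat \<Rightarrow> nat list set" where
  "B_set k = {xs. is_partition xs \<and> initial_repetitions k xs}"

definition Phi :: "nat \<Rightarrow> nat list \<Rightarrow> nat list" where
  "Phi k xs = (let c = conjugate xs in conjugate (part_add (flat_part k c) (strips k c)))"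

lemma part_0 [simp]: "part xs 0 = 0"
  by (simp add: part_def)

lemma part_eq_0: "length xs < i \<Longrightarrow> part xs i = 0"
  by (simp add: part_def)

lemma part_mono:
  assumes "is_partition xs" "1 \<le> i" "i \<le> j"
  shows "part xs j \<le> part xs i"
  using assms by (cases "i = j") (auto simp: part_def is_partition_def sorted_wrt_iff_nth_less)

lemma part_pos_iff:
  assumes "is_partition xs" "1 \<le> i"
  shows "0 < part xs i \<longleftrightarrow> i \<le> length xs"
proof (cases "i \<le> length xs")
  case True
  then have "xs ! (i - 1) \<in> set xs" using assms(2) by (intro nth_mem) linarith
  then have "xs ! (i - 1) \<noteq> 0" using assms(1) by (metis is_partition_def)
  then show ?thesis using True assms(2) by (simp add: part_def)
qed (simp add: part_def)

lemma nat_eqI_le: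
  fixes a b :: nat
  assumes "\<And>j. 1 \<le> j \<Longrightarrow> j \<le> a \<longleftrightarrow> j \<le> b"
  shows "a = b"
proof (rule antisym)
  show "a \<le> b" using assms[of a] by (cases a) auto
  show "b \<le> a" using assms[of b] by (cases b) auto
qed

lemma partition_eqI:
  assumes "is_partition xs" "is_partition ys" "\<And>i. 1 \<le> i \<Longrightarrow> part xs i = part ys i"
  shows "xs = ys"
proof (rule nth_equalityI)
  show l: "length xs = length ys"
  proof (rule nat_eqI_le)
    fix i :: nat assume i: "1 \<le> i"
    show "i \<le> length xs \<longleftrightarrow> i \<le> length ys"
      using part_pos_iff[OF assms(1) i] part_pos_iff[OF assms(2) i] assms(3)[OF i] by simp
  qed
  fix i assume "i < length xs"
  then show "xs ! i = ys ! i"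
    using assms(3)[of "Suc i"] l by (simp add: part_def)
qed

lemma of_parts_Suc: "of_parts f (Suc n) = of_parts f n @ (if 0 < f (Suc n) then [f (Suc n)] else [])"
  by (simp add: of_parts_def)

lemma is_partition_of_parts:
  assumes "\<And>i j. 1 \<le> i \<Longrightarrow> i \<le> j \<Longrightarrow> f j \<le> f i"
  shows "is_partition (of_parts f n)"
proof -
  have "sorted_wrt (\<ge>) (map f [1..<Suc n])"
    unfolding sorted_wrt_map using assms
    by (intro sorted_wrt_mono_rel[OF _ sorted_upt]) auto
  then have "sorted_wrt (\<ge>) (of_parts f n)"
    unfolding of_parts_def by (rule sorted_wrt_filter)
  then show ?thesis by (auto simp: is_partition_def of_parts_def)
qed

lemma part_of_parts_aux:
  assumes "\<And>i j. 1 \<le> i \<Longrightarrow> i \<le> j \<Longrightarrow> f j \<le> f i" "1 \<le> i"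
  shows "part (of_parts f n) i = (if i \<le> n then f i else 0)"
proof (induction n)
  case 0
  then show ?case using assms by (simp add: of_parts_def part_def)
next
  case (Suc n)
  show ?case
  proof (cases "0 < f (Suc n)")
    case True
    have "0 < f j" if "j \<in> set [1..<Suc (Suc n)]" for j
      using assms(1)[of j "Suc n"] that True by auto
    then have "of_parts f (Suc n) = map f [1..<Suc (Suc n)]"
      unfolding of_parts_def by (intro filter_True) auto
    then show ?thesis using assms(2) by (auto simp: part_def simp del: upt_Suc)
  next
    case False
    then show ?thesis using Suc assms(2) by (auto simp: of_parts_Suc le_Suc_eq)
  qed
qed

lemma part_of_parts:
  assumes "\<And>i j. 1 \<le> i \<Longrightarrow> i \<le> j \<Longrightarrow> f j \<le> f i" "\<And>i. n < i \<Longrightarrow> f i = 0" "1 \<le> i"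
  shows "part (of_parts f n) i = f i"
  using part_of_parts_aux[OF assms(1,3), where n = n] assms(2)[of i] by auto

lemma finite_parts_ge:
  assumes "1 \<le> i"
  shows "finite {j. 1 \<le> j \<and> i \<le> part xs j}"
  by (rule finite_subset[of _ "{..length xs}"]) (use assms in \<open>auto simp: part_def split: if_splits\<close>)

lemma conjugate_mono:
  assumes "1 \<le> i" "i \<le> (j::nat)"
  shows "card {l. 1 \<le> l \<and> j \<le> part xs l} \<le> card {l. 1 \<le> l \<and> i \<le> part xs l}"
  using assms by (intro card_mono finite_parts_ge) auto

lemma is_partition_conjugate: "is_partition (conjugate xs)"
  unfolding conjugate_def by (rule is_partition_of_parts) (rule conjugate_mono)

lemma part_conjugate:
  assumes "is_partition xs" "1 \<le> i"
  shows "part (conjugate xs) i = card {j. 1 \<le> j \<and> i \<le> part xs j}"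
  unfolding conjugate_def
proof (rule part_of_parts[OF _ _ assms(2)])
  fix i assume "part xs 1 < i"
  then have "{j. 1 \<le> j \<and> i \<le> part xs j} = {}"
    using part_mono[OF assms(1), of 1] by fastforce
  then show "card {j. 1 \<le> j \<and> i \<le> part xs j} = 0" by (simp only: card.empty)
qed (rule conjugate_mono)

lemma part_conjugate_ge_iff:
  assumes "is_partition xs" "1 \<le> i" "1 \<le> j"
  shows "j \<le> part (conjugate xs) i \<longleftrightarrow> i \<le> part xs j"
proof
  let ?S = "{j. 1 \<le> j \<and> i \<le> part xs j}"
  assume "i \<le> part xs j"
  then have "{1..j} \<subseteq> ?S" using part_mono[OF assms(1)] by (auto intro: order_trans)
  from card_mono[OF finite_parts_ge[OF assms(2)] this]
  show "j \<le> part (conjugate xs) i" using part_conjugate[OF assms(1,2)] by simp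
next
  let ?S = "{j. 1 \<le> j \<and> i \<le> part xs j}"
  assume *: "j \<le> part (conjugate xs) i"
  show "i \<le> part xs j"
  proof (rule ccontr)
    assume "\<not> i \<le> part xs j"
    then have "l < j" if "l \<in> ?S" for l
      using part_mono[OF assms(1,3), of l] that by (cases "l < j") auto
    then have "?S \<subseteq> {1..<j}" by auto
    from card_mono[OF _ this] have "card ?S \<le> j - 1" by simp
    then show False using * part_conjugate[OF assms(1,2)] assms(3) by simp
  qed
qed

lemma count_list_part:
  assumes "1 \<le> j"
  shows "count_list xs j = card {i. 1 \<le> i \<and> part xs i = j}"
proof -
  have "{i. 1 \<le> i \<and> part xs i = j} = Suc ` {i. i < length xs \<and> xs ! i = j}"
  proof (intro set_eqI iffI)
    fix i assume "i \<in> {i. 1 \<le> i \<and> part xs i = j}"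
    then have "i - 1 \<in> {i. i < length xs \<and> xs ! i = j}" "i = Suc (i - 1)"
      using assms by (auto simp: part_def split: if_splits)
    then show "i \<in> Suc ` {i. i < length xs \<and> xs ! i = j}" by (metis imageI)
  qed (auto simp: part_def)
  then show ?thesis
    by (simp add: card_image count_list_eq_length_filter length_filter_conv_card eq_commute)
qed

lemma count_conjugate:
  assumes "is_partition xs" "1 \<le> j"
  shows "count_list (conjugate xs) j = part xs j - part xs (j + 1)"
proof -
  have "part (conjugate xs) i = j \<longleftrightarrow> part xs (j + 1) < i \<and> i \<le> part xs j" if "1 \<le> i" for i
    using part_conjugate_ge_iff[OF assms(1) that, of j] part_conjugate_ge_iff[OF assms(1) that, of "j + 1"] assms(2)
    by linarith
  then have "{i. 1 \<le> i \<and> part (conjugate xs) i = j} = {part xs (j + 1)<..part xs j}"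
    by (intro set_eqI, case_tac "1 \<le> x") simp_all
  then show ?thesis using count_list_part[OF assms(2)] by simp
qed

lemma conjugate_conjugate:
  assumes "is_partition xs"
  shows "conjugate (conjugate xs) = xs"
proof (rule partition_eqI[OF is_partition_conjugate assms])
  fix i :: nat assume i: "1 \<le> i"
  show "part (conjugate (conjugate xs)) i = part xs i"
  proof (rule nat_eqI_le)
    fix j :: nat assume j: "1 \<le> j"
    show "j \<le> part (conjugate (conjugate xs)) i \<longleftrightarrow> j \<le> part xs i"
      using part_conjugate_ge_iff[OF is_partition_conjugate i j]
        part_conjugate_ge_iff[OF assms j i] by simp
  qed
qed

lemma flat_aux:
  assumes "is_partition xs" "1 \<le> i"
  shows "k * (\<Sum>j = i..length xs. strip_count k xs j) \<le> part xs i \<and>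
    (part xs i - k * (\<Sum>j = i..length xs. strip_count k xs j)) =
    (\<Sum>j = i..length xs. (part xs j - part xs (j + 1)) mod k)"
proof -
  have "part xs i = (\<Sum>j = i..length xs. part xs j - part xs (j + 1))"
  proof (cases "i \<le> Suc (length xs)")
    case True
    then show ?thesis
    proof (induction rule: inc_induct)
      case base
      then show ?case by (simp add: part_eq_0)
    next
      case (step n)
      then have "1 \<le> n" using \<open>1 \<le> i\<close> by simp
      then have "part xs (Suc n) \<le> part xs n" using part_mono[OF assms(1)] by simp
      then show ?case using step by (simp add: sum.atLeast_Suc_atMost)
    qed
  qed (simp add: part_eq_0)
  also have "\<dots> = k * (\<Sum>j = i..length xs. strip_count k xs j) +
    (\<Sum>j = i..length xs. (part xs j - part xs (j + 1)) mod k)"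
    by (simp add: strip_count_def sum_distrib_left flip: sum.distrib)
  finally show ?thesis by simp
qed

lemma flat_mono:
  assumes "is_partition xs" "1 \<le> i" "i \<le> l"
  shows "part xs l - k * (\<Sum>j = l..length xs. strip_count k xs j)
    \<le> part xs i - k * (\<Sum>j = i..length xs. strip_count k xs j)"
proof -
  have "1 \<le> l" using assms by simp
  show ?thesis
    unfolding conjunct2[OF flat_aux[OF assms(1,2)]] conjunct2[OF flat_aux[OF assms(1) \<open>1 \<le> l\<close>]]
    by (rule sum_mono2) (use assms in auto)
qed

lemma is_partition_flat_part:
  assumes "is_partition xs"
  shows "is_partition (flat_part k xs)"
  unfolding flat_part_def by (intro is_partition_of_parts flat_mono assms)

lemma part_flat_part:
  assumes "is_partition xs" "1 \<le> i"
  shows "part (flat_part k xs) i = (\<Sum>j = i..length xs. (part xs j - part xs (j + 1)) mod k)"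
  unfolding flat_part_def conjunct2[OF flat_aux[OF assms], symmetric]
  by (rule part_of_parts) (use assms flat_mono in \<open>auto simp: part_eq_0\<close>)

lemma part_flat_part_diff:
  assumes "is_partition xs" "1 \<le> i"
  shows "part (flat_part k xs) i = part (flat_part k xs) (i + 1) + (part xs i - part xs (i + 1)) mod k"
proof (cases "i \<le> length xs")
  case True
  then show ?thesis using assms by (simp add: part_flat_part sum.atLeast_Suc_atMost)
next
  case False
  then show ?thesis using assms by (simp add: part_flat_part part_eq_0)
qed

lemma k_flat_flat_part:
  assumes "is_partition xs" "0 < k"
  shows "k_flat k (flat_part k xs)"
  unfolding k_flat_def
proof (intro allI impI)
  fix i :: nat assume i: "1 \<le> i"
  show "part (flat_part k xs) i - part (flat_part k xs) (i + 1) < k"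
    unfolding part_flat_part_diff[OF assms(1) i, of k] using assms(2) by simp
qed

lemma partition_eqI_diff:
  assumes "is_partition xs" "is_partition ys"
    "\<And>i. 1 \<le> i \<Longrightarrow> part xs i - part xs (i + 1) = part ys i - part ys (i + 1)"
  shows "xs = ys"
proof (rule partition_eqI[OF assms(1,2)])
  fix i :: nat assume "1 \<le> i"
  let ?n = "max i (Suc (max (length xs) (length ys)))"
  have "i \<le> ?n" by simp
  then show "part xs i = part ys i"
  proof (induction rule: inc_induct)
    case base
    then show ?case by (simp add: part_eq_0)
  next
    case (step n)
    then have "1 \<le> n" using \<open>1 \<le> i\<close> by simp
    then show ?case
      using step assms(3)[of n] part_mono[OF assms(1), of n "Suc n"] part_mono[OF assms(2), of n "Suc n"]
      by simp
  qed
qed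

lemma count_strips:
  assumes "0 < k"
  shows "count_list (strips k xs) x =
    (if k dvd x \<and> 1 \<le> x div k \<and> x div k \<le> length xs then strip_count k xs (x div k) else 0)"
proof -
  have rep: "count_list (replicate n a) b = (if a = b then n else 0)" for n and a b :: nat
    by (induction n) auto
  have "count_list (concat (map (\<lambda>i. replicate (c i) (k * i)) (rev [1..<Suc n]))) x
    = (if k dvd x \<and> 1 \<le> x div k \<and> x div k \<le> n then c (x div k) else 0)" for c n
  proof (induction n)
    case (Suc n)
    have "k * Suc n = x \<longleftrightarrow> k dvd x \<and> x div k = Suc n"
      using assms by auto
    then show ?case using Suc by (auto simp: rep simp del: mult_Suc_right)
  qed simp
  then show ?thesis by (simp add: strips_def)
qed

lemma is_partition_strips:
  assumes "0 < k"
  shows "is_partition (strips k xs)"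
proof -
  have "sorted_wrt (\<ge>) (concat (map (\<lambda>i. replicate (c i) (k * i)) (rev [1..<Suc n])))" for c n
  proof (induction n)
    case (Suc n)
    have "y \<le> k * Suc n" if "y \<in> set (concat (map (\<lambda>i. replicate (c i) (k * i)) (rev [1..<Suc n])))" for y
      using that by (auto simp del: upt_Suc mult_Suc_right)
    moreover have "sorted_wrt (\<ge>) (replicate m a)" for m and a :: nat
      by (induction m) auto
    ultimately show ?case using Suc by (simp add: sorted_wrt_append del: mult_Suc_right)
  qed simp
  moreover have "0 \<notin> set (strips k xs)"
    using assms by (auto simp: strips_def)
  ultimately show ?thesis unfolding is_partition_def strips_def by blast
qed

lemma remove_strip_parts:
  assumes "is_partition xs" "1 \<le> i" "i \<le> length xs" "k \<le> part xs i - part xs (i + 1)"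
  shows "is_partition (remove_strip k i xs)"
    and "\<And>j. 1 \<le> j \<Longrightarrow> part (remove_strip k i xs) j = part xs j - (if j \<le> i then k else 0)"
proof -
  have *: "part xs l - (if l \<le> i then k else 0) \<le> part xs j - (if j \<le> i then k else 0)"
    if "1 \<le> j" "j \<le> l" for j l
  proof (cases "j \<le> i \<and> i < l")
    case True
    then show ?thesis
      using part_mono[OF assms(1), of j i] part_mono[OF assms(1), of "i + 1" l]
        part_mono[OF assms(1) that] that assms(4)
      by simp
  next
    case False
    then show ?thesis using part_mono[OF assms(1) that] that by auto
  qed
  show "is_partition (remove_strip k i xs)"
    unfolding remove_strip_def by (rule is_partition_of_parts) (rule *)
  show "part (remove_strip k i xs) j = part xs j - (if j \<le> i then k else 0)" if "1 \<le> j" for j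
    unfolding remove_strip_def by (rule part_of_parts[OF _ _ that]) (use * in \<open>auto simp: part_eq_0\<close>)
qed

lemma remove_strip_diff:
  assumes "is_partition xs" "1 \<le> i" "i \<le> length xs" "k \<le> part xs i - part xs (i + 1)" "1 \<le> j"
  shows "part (remove_strip k i xs) j - part (remove_strip k i xs) (j + 1) =
    part xs j - part xs (j + 1) - (if j = i then k else 0)"
proof -
  have "k \<le> part xs (j + 1)" if "j < i"
    using part_mono[OF assms(1), of "j + 1" i] that assms(4) by simp
  then show ?thesis
    using assms(5) by (auto simp: remove_strip_parts(2)[OF assms(1-4)])
qed

lemma strip_step_invariant:
  assumes "strip_step k (xs, D) (ys, E)" "is_partition xs" "0 < k"
  shows "is_partition ys" "flat_part k ys = flat_part k xs"
    "mset (strips k ys) + E = mset (strips k xs) + D" "sum_list ys < sum_list xs"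
proof -
  from assms(1) obtain i where i: "1 \<le> i" "i \<le> length xs" "k \<le> part xs i - part xs (i + 1)"
    and ys: "ys = remove_strip k i xs" and E: "E = add_mset (k * i) D"
    by (auto elim: strip_step.cases)
  note d = remove_strip_diff[OF assms(2) i, folded ys]
  note p = remove_strip_parts(2)[OF assms(2) i, folded ys]
  show yp: "is_partition ys" using remove_strip_parts(1)[OF assms(2) i] ys by simp
  show "flat_part k ys = flat_part k xs"
  proof (rule partition_eqI_diff[OF is_partition_flat_part is_partition_flat_part])
    fix j :: nat assume j: "1 \<le> j"
    show "part (flat_part k ys) j - part (flat_part k ys) (j + 1)
      = part (flat_part k xs) j - part (flat_part k xs) (j + 1)"
      using part_flat_part_diff[OF yp j, of k] part_flat_part_diff[OF assms(2) j, of k] d[OF j] i(3)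
      by (auto simp: le_mod_geq)
  qed (use yp assms in auto)
  have sc: "strip_count k xs j = strip_count k ys j + (if j = i then 1 else 0)" if "1 \<le> j" for j
    using d[OF that] i(3) assms(3) by (auto simp: strip_count_def le_div_geq)
  have cs: "count_list (strips k zs) x =
    (if k dvd x \<and> 1 \<le> x div k then strip_count k zs (x div k) else 0)" for zs x
    using assms(3) by (auto simp: count_strips strip_count_def part_eq_0)
  show "mset (strips k ys) + E = mset (strips k xs) + D"
  proof (rule multiset_eqI)
    fix x
    show "count (mset (strips k ys) + E) x = count (mset (strips k xs) + D) x"
    proof (cases "k dvd x \<and> 1 \<le> x div k")
      case True
      then show ?thesis unfolding E using sc[of "x div k"] assms(3)
        by (auto simp: cs count_mset)
    next
      case False
      then have "x \<noteq> k * i" using i(1) assms(3) by auto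
      then show ?thesis unfolding E using False by (auto simp: cs count_mset)
    qed
  qed
  have sl: "sum_list zs = (\<Sum>j = 1..n. part zs j)" if "length zs \<le> n" for zs n
  proof -
    have "sum_list zs = (\<Sum>j<length zs. part zs (Suc j))"
      by (simp add: sum_list_sum_nth part_def atLeast0LessThan)
    also have "\<dots> = (\<Sum>j = 1..length zs. part zs j)"
      by (simp add: sum.atLeast_Suc_atMost_Suc_shift atLeast0LessThan sum.atLeast1_atMost_eq)
    also have "\<dots> = (\<Sum>j = 1..n. part zs j)"
      by (rule sum.mono_neutral_left) (use that in \<open>auto simp: part_eq_0\<close>)
    finally show ?thesis .
  qed
  have "length ys \<le> length xs"
    unfolding ys remove_strip_def of_parts_def
    by (rule order_trans[OF length_filter_le]) (simp del: upt_Suc)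
  then have "sum_list ys = (\<Sum>j = 1..length xs. part ys j)" by (rule sl)
  also have "\<dots> < (\<Sum>j = 1..length xs. part xs j)"
  proof (rule sum_strict_mono_ex1)
    have "part ys i < part xs i" using i p[OF i(1)] assms(3) by simp
    then show "\<exists>j\<in>{1..length xs}. part ys j < part xs j" using i by auto
  qed (auto simp: p)
  also have "\<dots> = sum_list xs" by (rule sl[symmetric]) simp
  finally show "sum_list ys < sum_list xs" .
qed

lemma flat_fixpoint:
  assumes "is_partition xs" "k_flat k xs" "0 < k"
  shows "flat_part k xs = xs" "strips k xs = []"
proof -
  show "flat_part k xs = xs"
  proof (rule partition_eqI_diff[OF is_partition_flat_part[OF assms(1)] assms(1)])
    fix j :: nat assume j: "1 \<le> j"
    show "part (flat_part k xs) j - part (flat_part k xs) (j + 1) = part xs j - part xs (j + 1)"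
      using part_flat_part_diff[OF assms(1) j, of k] assms(2) j by (simp add: k_flat_def)
  qed
  have "strip_count k xs j = 0" if "1 \<le> j" for j
    using assms that by (simp add: strip_count_def k_flat_def)
  then show "strips k xs = []"
    by (auto simp: strips_def)
qed

lemma strip_steps_invariant:
  assumes "(strip_step k)\<^sup>*\<^sup>* (xs, D) (ys, E)" "is_partition xs" "0 < k"
  shows "is_partition ys \<and> flat_part k ys = flat_part k xs \<and>
    mset (strips k ys) + E = mset (strips k xs) + D"
  using assms(1)
proof (induction "(ys, E)" arbitrary: ys E rule: rtranclp_induct)
  case base
  then show ?case using assms by simp
next
  case (step y)
  obtain zs F where "y = (zs, F)" by (cases y)
  then show ?case using step strip_step_invariant[of k zs F ys E] assms(3) by auto
qed

theorem strip_removal_unique: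
  assumes "is_partition xs" "0 < k" "(strip_step k)\<^sup>*\<^sup>* (xs, {#}) (ys, E)" "k_flat k ys"
  shows "ys = flat_part k xs \<and> E = mset (strips k xs)"
  using strip_steps_invariant[OF assms(3,1,2)] flat_fixpoint[of ys k] assms by auto

theorem strip_removal_exists:
  assumes "is_partition xs" "0 < k"
  shows "(strip_step k)\<^sup>*\<^sup>* (xs, {#}) (flat_part k xs, mset (strips k xs))"
    and "k_flat k (flat_part k xs)"
proof -
  have "\<exists>ys E. (strip_step k)\<^sup>*\<^sup>* (xs, D) (ys, E) \<and> k_flat k ys" if "is_partition xs" for xs D
    using that
  proof (induction "sum_list xs" arbitrary: xs D rule: less_induct)
    case less
    show ?case
    proof (cases "k_flat k xs")
      case True
      then show ?thesis by blast
    next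
      case False
      then obtain i where i: "1 \<le> i" "k \<le> part xs i - part xs (i + 1)"
        by (auto simp: k_flat_def not_less)
      then have "0 < part xs i" using assms(2) by linarith
      then have "i \<le> length xs" using part_pos_iff[OF less.prems i(1)] by simp
      then have s: "strip_step k (xs, D) (remove_strip k i xs, add_mset (k * i) D)"
        using i by (intro strip_step.intros)
      show ?thesis
        using less.hyps[OF strip_step_invariant(4,1)[OF s less.prems assms(2)], of "add_mset (k * i) D"] s
        by (meson converse_rtranclp_into_rtranclp)
    qed
  qed
  from this[OF assms(1), of "{#}"] show "(strip_step k)\<^sup>*\<^sup>* (xs, {#}) (flat_part k xs, mset (strips k xs))"
    using strip_removal_unique[OF assms] by blast
  show "k_flat k (flat_part k xs)" using k_flat_flat_part[OF assms] .
qed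

lemma part_add_parts:
  assumes "is_partition xs" "is_partition ys"
  shows "is_partition (part_add xs ys)"
    and "\<And>i. 1 \<le> i \<Longrightarrow> part (part_add xs ys) i = part xs i + part ys i"
proof -
  have *: "part xs j + part ys j \<le> part xs i + part ys i" if "1 \<le> i" "i \<le> j" for i j
    using part_mono[OF assms(1) that] part_mono[OF assms(2) that] by simp
  show "is_partition (part_add xs ys)"
    unfolding part_add_def by (rule is_partition_of_parts) (rule *)
  show "part (part_add xs ys) i = part xs i + part ys i" if "1 \<le> i" for i
    unfolding part_add_def by (rule part_of_parts[OF _ _ that]) (use * in \<open>auto simp: part_eq_0\<close>)
qed

lemma Phi_in_B:
  assumes "0 < k" "xs \<in> A_set k"
  shows "Phi k xs \<in> B_set k"
proof -
  define c d f a where "c = conjugate xs" and "d = strips k c" and "f = flat_part k c"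
    and "a = part_add f d"
  have xp: "is_partition xs" using assms by (simp add: A_set_def)
  have cp: "is_partition c" by (simp add: c_def is_partition_conjugate)
  have dp: "is_partition d" using is_partition_strips[OF assms(1)] by (simp add: d_def)
  have fp: "is_partition f" using is_partition_flat_part[OF cp] by (simp add: f_def)
  have ap: "is_partition a" using part_add_parts(1)[OF fp dp] by (simp add: a_def)
  have Phi: "Phi k xs = conjugate a" by (simp add: Phi_def Let_def a_def f_def d_def c_def)
  have cd: "part c j - part c (j + 1) \<le> 2 * k - 1" if "1 \<le> j" for j
    using count_conjugate[OF cp that] assms(2) conjugate_conjugate[OF xp]
    by (simp add: c_def A_set_def del: One_nat_def) metis
  have sc: "strip_count k c j \<le> 1" if "1 \<le> j" for j
  proof -
    have "part c j - part c (j + 1) < 2 * k" using cd[OF that] assms(1) by linarith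
    then have "(part c j - part c (j + 1)) div k < 2" by (rule less_mult_imp_div_less)
    then show ?thesis by (simp add: strip_count_def)
  qed
  have "count_list d x \<le> 1" for x
    using sc[of "x div k"] by (auto simp: d_def count_strips[OF assms(1)])
  then have dist: "part d i \<noteq> part d j" if "1 \<le> i" "i < j" "0 < part d i" for i j
  proof -
    have "finite {l. 1 \<le> l \<and> part d l = part d i}"
      by (rule finite_subset[OF _ finite_parts_ge[of "part d i" d]]) (use that in auto)
    moreover have "card {l. 1 \<le> l \<and> part d l = part d i} \<le> 1"
      using count_list_part[of "part d i" d] that \<open>count_list d (part d i) \<le> 1\<close> by simp
    ultimately have "\<And>u v. u \<in> {l. 1 \<le> l \<and> part d l = part d i} \<Longrightarrow>
        v \<in> {l. 1 \<le> l \<and> part d l = part d i} \<Longrightarrow> u = v"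
      by (metis One_nat_def card_le_Suc0_iff_eq)
    from this[of i j] show ?thesis using that by auto
  qed
  have dvd: "k dvd part d i" for i
  proof (cases "1 \<le> i \<and> i \<le> length d")
    case True
    then have "part d i \<in> set d" by (auto simp: part_def intro!: nth_mem)
    then show ?thesis by (auto simp: d_def strips_def)
  qed (auto simp: part_def)
  have dd: "part d (j + 1) + k \<le> part d j" if "1 \<le> j" "0 < part d j" for j
  proof -
    have "part d (j + 1) < part d j"
      using dist[of j "j + 1"] part_mono[OF dp, of j "j + 1"] that by simp
    moreover obtain u v where "part d (j + 1) = k * u" "part d j = k * v"
      using dvd by (meson dvdE)
    ultimately show ?thesis
      using assms(1) by (simp flip: mult_Suc_right add: add.commute)
  qed
  have ad: "part a j = part f j + part d j" if "1 \<le> j" for j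
    using part_add_parts(2)[OF fp dp that] by (simp add: a_def)
  have fd: "part f j - part f (j + 1) < k" "part f (j + 1) \<le> part f j" if "1 \<le> j" for j
    using k_flat_flat_part[OF cp assms(1)] part_mono[OF fp, of j "j + 1"] that
    by (auto simp: k_flat_def f_def)
  have "k \<le> count_list (conjugate a) i"
    if j: "j \<in> set (conjugate a)" "k \<le> count_list (conjugate a) j" and i: "0 < i" "i < j" for i j
  proof -
    have j1: "1 \<le> j" and i1: "1 \<le> i" using i by auto
    have "part d (j + 1) < part d j"
      using j(2) count_conjugate[OF ap j1] ad[of j] ad[of "j + 1"] fd[OF j1] j1 assms(1) by auto
    then have "0 < part d i" using part_mono[OF dp i1, of j] i by linarith
    then have "part a (i + 1) + k \<le> part a i"
      using dd[OF i1] ad[of i] ad[of "i + 1"] fd(2)[OF i1] i1 by simp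
    then show ?thesis using count_conjugate[OF ap i1] by simp
  qed
  then show ?thesis
    using is_partition_conjugate[of a] unfolding Phi B_set_def initial_repetitions_def by blast
qed

end

theory Submission
  imports Defs
begin

text \<open>A partition is determined by the differences of its consecutive parts. Write \<open>c\<close> for the
  conjugate of \<open>\<lambda>\<close>. The differences of \<open>\<pi>\<close> are those of \<open>c\<close> modulo \<open>k\<close>, and the differences of
  \<open>\<delta>\<close> are multiples of \<open>k\<close>; so the differences of \<open>\<alpha> = \<pi> + \<delta>\<close>, divided by \<open>k\<close> with remainder,
  give back \<open>\<pi>\<close> and \<open>\<delta>\<close>, hence \<open>c\<close>. Conversely, splitting the differences of any \<open>\<alpha>\<close> in this
  way gives a pair \<open>(\<pi>, \<delta>)\<close> coming from some \<open>c\<close>. When \<open>\<alpha>'\<close> has initial \<open>k\<close>-repetitions, the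
  differences that are at least \<open>k\<close> form an initial segment, so \<open>\<delta>\<close> has distinct parts, the
  differences of \<open>c\<close> are below \<open>2k\<close>, and \<open>\<lambda> \<in> A\<^sub>k\<close>.\<close>

section \<open>Partitions described by gaps or multiplicities\<close>

abbreviation gap :: "nat list \<Rightarrow> nat \<Rightarrow> nat" where
  "gap xs i \<equiv> part xs i - part xs (i + 1)"

text \<open>The tail sums of \<open>g\<close> decrease weakly and telescope, so every finitely
  supported sequence is the gap sequence of a partition.\<close>

lemma ex_partition_gap:
  assumes "\<And>i. n < i \<Longrightarrow> g i = 0"
  shows "\<exists>xs. is_partition xs \<and> (\<forall>i\<ge>1. part xs i = (\<Sum>j = i..n. g j) \<and> gap xs i = g i)"
proof -
  let ?f = "\<lambda>i. \<Sum>j = i..n. g j"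
  have mono: "?f j \<le> ?f i" if "i \<le> j" for i j
    by (rule sum_mono2) (use that in auto)
  have p: "part (of_parts ?f n) i = ?f i" if "1 \<le> i" for i
    by (rule part_of_parts) (use mono that in auto)
  have "?f i - ?f (i + 1) = g i" for i
    using assms[of i] by (cases "i \<le> n") (auto simp: sum.atLeast_Suc_atMost)
  then have "\<forall>i\<ge>1. part (of_parts ?f n) i = ?f i \<and> gap (of_parts ?f n) i = g i"
    by (simp add: p)
  moreover have "is_partition (of_parts ?f n)"
    by (rule is_partition_of_parts) (rule mono)
  ultimately show ?thesis by blast
qed

lemma partition_eqI_count:
  assumes "is_partition xs" "is_partition ys" "\<And>x. count_list xs x = count_list ys x"
  shows "xs = ys"
proof -
  \<comment> \<open>\<open>sorted\<close> means increasing, hence the reversal; a sorted list is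
    determined by its multiset.\<close>
  have "sorted (rev xs)" "sorted (rev ys)"
    using assms by (simp_all add: is_partition_def sorted_wrt_rev)
  moreover have "mset (rev xs) = mset (rev ys)"
    using assms(3) by (intro multiset_eqI) (simp add: count_mset)
  ultimately have "rev xs = rev ys"
    by (metis properties_for_sort)
  then show ?thesis by simp
qed

lemma gap_part_add:
  assumes "is_partition xs" "is_partition ys" "1 \<le> i"
  shows "gap (part_add xs ys) i = gap xs i + gap ys i"
  using part_mono[OF assms(1,3), of "i + 1"] part_mono[OF assms(2,3), of "i + 1"]
  part_add_parts(2)[OF assms] part_add_parts(2)[OF assms(1,2), of "i + 1"]
  by simp

lemma gap_flat_part:
  assumes "is_partition xs" "1 \<le> i"
  shows "gap (flat_part k xs) i = gap xs i mod k"
  using part_flat_part_diff[OF assms, of k] by simp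

lemma dvd_part:
  assumes "\<And>x. x \<in> set xs \<Longrightarrow> k dvd x"
  shows "k dvd part xs i"
proof (cases "1 \<le> i \<and> i \<le> length xs")
  case True
  then have "xs ! (i - 1) \<in> set xs" by (intro nth_mem) linarith
  then show ?thesis using assms True by (simp add: part_def)
qed (auto simp: part_def)

lemma dvd_gap_strips: "k dvd gap (strips k xs) i"
proof -
  have "k dvd part (strips k xs) j" for j
    by (rule dvd_part) (auto simp: strips_def)
  then show ?thesis by (simp add: dvd_diff_nat)
qed

lemma strip_count_eq_count_list:
  assumes "0 < k" "1 \<le> i"
  shows "strip_count k xs i = count_list (strips k xs) (k * i)"
  using assms by (auto simp: count_strips strip_count_def part_eq_0)

section \<open>Injectivity of strip removal followed by addition\<close>

lemma flat_strips_determine: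
  assumes "is_partition c" "is_partition c'" "0 < k"
    "part_add (flat_part k c) (strips k c) = part_add (flat_part k c') (strips k c')"
  shows "c = c'"
proof -
  have g: "gap (part_add (flat_part k c) (strips k c)) i = gap c i mod k + gap (strips k c) i"
    if "is_partition c" "1 \<le> i" for c i
    using gap_part_add[OF is_partition_flat_part[OF that(1)] is_partition_strips[OF assms(3)] that(2)]
      gap_flat_part[OF that] by simp
  have split: "gap c i mod k = gap c' i mod k \<and> gap (strips k c) i = gap (strips k c') i"
    if "1 \<le> i" for i
  proof -
    have eq: "gap c i mod k + gap (strips k c) i = gap c' i mod k + gap (strips k c') i"
      using g[OF assms(1) that] g[OF assms(2) that] assms(4) by simp
    obtain u v where uv: "gap (strips k c) i = k * u" "gap (strips k c') i = k * v"
      using dvd_gap_strips by (meson dvdE)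
    \<comment> \<open>Modulo \<open>k\<close> the gaps of the strips vanish, and the other summands
      are already reduced.\<close>
    have "gap c i mod k = gap c' i mod k"
      using arg_cong[OF eq, of "\<lambda>x. x mod k"] unfolding uv by simp
    then show ?thesis using eq by simp
  qed
  have strips: "strips k c = strips k c'"
    by (rule partition_eqI_diff) (use split is_partition_strips[OF assms(3)] in auto)
  show ?thesis
  proof (rule partition_eqI_diff[OF assms(1,2)])
    fix i :: nat assume i: "1 \<le> i"
    \<comment> \<open>The quotient is not a gap of \<delta>: it is the multiplicity of the part
      \<open>k * i\<close> in \<delta>.\<close>
    have "gap c i div k = gap c' i div k"
      using strip_count_eq_count_list[OF assms(3) i, of c]
        strip_count_eq_count_list[OF assms(3) i, of c'] strips
      by (simp add: strip_count_def)
    then show "gap c i = gap c' i" using split[OF i] by (metis div_mult_mod_eq)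
  qed
qed

section \<open>Construction of a preimage\<close>

text \<open>Remainder and quotient of each gap can be prescribed independently: \<open>r\<close>
  fixes the flat part, and the multiplicity of \<open>k * i\<close> in \<open>d\<close> is the
  number of strips of length \<open>i\<close>.\<close>

lemma ex_strips_flat_part:
  assumes "0 < k" "is_partition d" "\<And>x. x \<in> set d \<Longrightarrow> k dvd x"
    and "\<And>i. r i < k" "\<And>i. n < i \<Longrightarrow> r i = 0"
  shows "\<exists>c. is_partition c \<and> strips k c = d \<and>
    (\<forall>i\<ge>1. gap c i = r i + k * count_list d (k * i) \<and> gap (flat_part k c) i = r i)"
proof -
  \<comment> \<open>No part exceeds the sum of all parts, so \<open>sum_list d\<close> bounds the
    support of the quotients.\<close>
  have "count_list d (k * i) = 0" if "sum_list d < i" for i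
  proof (rule ccontr)
    assume "count_list d (k * i) \<noteq> 0"
    then have "k * i \<in> set d" using count_notin by fastforce
    then have "k * i \<le> sum_list d" by (rule member_le_sum_list) simp
    moreover have "i \<le> k * i" using assms(1) by simp
    ultimately show False using that by linarith
  qed
  then have "r i + k * count_list d (k * i) = 0" if "max n (sum_list d) < i" for i
    using that assms(5) by simp
  from ex_partition_gap[of _ "\<lambda>i. r i + k * count_list d (k * i)", OF this]
  obtain c where c: "is_partition c"
    and gc: "\<And>i. 1 \<le> i \<Longrightarrow> gap c i = r i + k * count_list d (k * i)"
    by blast
  have "gap (flat_part k c) i = r i" if "1 \<le> i" for i
    using gap_flat_part[OF c that] gc[OF that] assms(4)[of i] by simp
  moreover have "strips k c = d"
  proof (rule partition_eqI_count[OF is_partition_strips[OF assms(1)] assms(2)])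
    fix x
    show "count_list (strips k c) x = count_list d x"
    proof (cases "k dvd x \<and> 1 \<le> x div k")
      case True
      then have "strip_count k c (x div k) = count_list d x"
        using gc[of "x div k"] assms(1) assms(4)[of "x div k"] by (simp add: strip_count_def)
      then show ?thesis
        using strip_count_eq_count_list[OF assms(1), of "x div k" c] True by simp
    next
      case False
      then have "x = 0 \<or> \<not> k dvd x" using assms(1) by auto
      then have "x \<notin> set d" using assms(2,3) by (auto simp: is_partition_def)
      then show ?thesis using False assms(1) by (auto simp: count_strips)
    qed
  qed
  ultimately show ?thesis using c gc by blast
qed

lemma count_list_le_1:
  assumes "is_partition xs" "\<And>i. 1 \<le> i \<Longrightarrow> 0 < part xs i \<Longrightarrow> part xs (i + 1) < part xs i"
  shows "count_list xs x \<le> 1"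
proof (cases "x = 0")
  case True
  then show ?thesis using assms(1) by (simp add: is_partition_def)
next
  case False
  \<comment> \<open>For \<open>x = 0\<close> this set would be infinite, since \<open>part\<close>
    is 0 past the end; hence the case split.\<close>
  let ?S = "{i. 1 \<le> i \<and> part xs i = x}"
  have less: "\<not> i < j" if "i \<in> ?S" "j \<in> ?S" for i j
  proof
    assume "i < j"
    then have "part xs j \<le> part xs (i + 1)" using part_mono[OF assms(1), of "i + 1" j] by simp
    then show False using assms(2)[of i] that False by simp
  qed
  have "i = j" if "i \<in> ?S" "j \<in> ?S" for i j
    using less[OF that] less[OF that(2,1)] by simp
  moreover have "finite ?S"
    by (rule finite_subset[OF _ finite_parts_ge[of x xs]]) (use False in auto)
  ultimately have "card ?S \<le> 1" by (auto simp: card_le_Suc0_iff_eq)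
  then show ?thesis using count_list_part[of x xs] False by simp
qed

lemma ex_Phi_preimage:
  assumes "0 < k" "b \<in> B_set k"
  shows "\<exists>xs \<in> A_set k. Phi k xs = b"
proof -
  define a where "a = conjugate b"
  have b: "is_partition b" and ini: "initial_repetitions k b"
    using assms(2) by (auto simp: B_set_def)
  have a: "is_partition a" by (simp add: a_def is_partition_conjugate)
  have ca: "conjugate a = b" using conjugate_conjugate[OF b] by (simp add: a_def)
  have ga: "gap a i = count_list b i" if "1 \<le> i" for i
    using count_conjugate[OF a that] ca by simp
  have ga0: "gap a i = 0" if "length a < i" for i
    using that by (simp add: part_eq_0)
  \<comment> \<open>\<delta> is forced: the gaps of a flat part are below \<open>k\<close>, so
    \<delta> must carry the multiple of \<open>k\<close> contained in each gap of \<alpha>.\<close>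
  obtain d where d: "is_partition d"
    and pd: "\<And>i. 1 \<le> i \<Longrightarrow> part d i = (\<Sum>j = i..length a. k * (gap a j div k))"
    and gd: "\<And>i. 1 \<le> i \<Longrightarrow> gap d i = k * (gap a i div k)"
  proof -
    have "\<exists>d. is_partition d \<and> (\<forall>i\<ge>1. part d i = (\<Sum>j = i..length a. k * (gap a j div k)) \<and>
        gap d i = k * (gap a i div k))"
      by (rule ex_partition_gap) (simp only: ga0 div_0 mult_0_right)
    then show thesis using that by blast
  qed
  have dvd: "k dvd x" if "x \<in> set d" for x
  proof -
    obtain i where "i < length d" "d ! i = x"
      using \<open>x \<in> set d\<close> by (auto simp: in_set_conv_nth)
    then have "x = part d (Suc i)" by (simp add: part_def)
    then show ?thesis using pd[of "Suc i"] by (auto intro: dvd_sum)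
  qed
  have dist: "part d (i + 1) < part d i" if i: "1 \<le> i" "0 < part d i" for i
  proof -
    \<comment> \<open>A positive tail sum has a nonzero term, so some gap of \<open>a\<close> at an
      index \<open>j\<close> not before \<open>i\<close> is at least \<open>k\<close>. That gap is
      the multiplicity of \<open>j\<close> in \<open>b\<close>, and initial repetitions carry the
      bound back to \<open>i\<close>.\<close>
    have "\<exists>j\<in>{i..length a}. k * (gap a j div k) \<noteq> 0"
      using i(2) unfolding pd[OF i(1)] by (metis (no_types, lifting) not_less_zero sum.neutral)
    then obtain j where j: "i \<le> j" "gap a j div k \<noteq> 0" by auto
    then have jk: "k \<le> count_list b j" using ga[of j] i(1) by (simp add: div_eq_0_iff)
    then have "j \<in> set b" using assms(1) count_notin[of j b] by fastforce
    then have "k \<le> count_list b i"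
      using ini jk j(1) i(1) unfolding initial_repetitions_def by (cases "i = j") auto
    then have "0 < gap d i"
      using gd[OF i(1)] ga[OF i(1)] assms(1) by (simp add: div_greater_zero_iff)
    then show ?thesis by simp
  qed
  obtain c where c: "is_partition c" and sc: "strips k c = d"
    and gc: "\<And>i. 1 \<le> i \<Longrightarrow> gap c i = gap a i mod k + k * count_list d (k * i)"
    and gf: "\<And>i. 1 \<le> i \<Longrightarrow> gap (flat_part k c) i = gap a i mod k"
  proof -
    have "\<exists>c. is_partition c \<and> strips k c = d \<and>
      (\<forall>i\<ge>1. gap c i = gap a i mod k + k * count_list d (k * i) \<and>
        gap (flat_part k c) i = gap a i mod k)"
      by (rule ex_strips_flat_part[OF assms(1) d dvd, where n = "length a"])
        (simp_all only: ga0 mod_0 mod_less_divisor[OF assms(1)])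
    then show thesis using that by blast
  qed
  have pa: "part_add (flat_part k c) d = a"
  proof (rule partition_eqI_diff[OF _ a])
    show "is_partition (part_add (flat_part k c) d)"
      by (rule part_add_parts(1)[OF is_partition_flat_part[OF c] d])
    show "gap (part_add (flat_part k c) d) i = gap a i" if "1 \<le> i" for i
      using gap_part_add[OF is_partition_flat_part[OF c] d that] gf[OF that] gd[OF that] by simp
  qed
  have "Phi k (conjugate c) = b"
    using conjugate_conjugate[OF c] sc pa ca by (simp add: Phi_def)
  moreover have "count_list (conjugate c) j \<le> 2 * k - 1" for j
  proof (cases "j = 0")
    case True
    then show ?thesis using is_partition_conjugate[of c] by (simp add: is_partition_def)
  next
    case False
    then have j: "1 \<le> j" by simp
    have "gap a j mod k < k" using assms(1) by simp
    \<comment> \<open>The parts of \<open>d\<close> are distinct, so there is at most one strip of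
      each length and the gap stays below \<open>k + k\<close>.\<close>
    moreover have "k * count_list d (k * j) \<le> k"
      using mult_le_mono2[OF count_list_le_1[OF d dist, of "k * j"], of k] by simp
    ultimately show ?thesis using count_conjugate[OF c j] gc[OF j] by linarith
  qed
  ultimately show ?thesis
    using is_partition_conjugate[of c] by (auto simp: A_set_def)
qed

theorem lemma1:
  fixes k :: nat
  assumes "k \<ge> 1"
  shows "\<forall>\<beta>\<in>B_set k. \<exists>!xs. xs \<in> A_set k \<and> Phi k xs = \<beta>"
proof
  fix b assume b: "b \<in> B_set k"
  have k: "0 < k" using assms by simp
  have inj: "xs = ys" if xs: "xs \<in> A_set k" and ys: "ys \<in> A_set k" and eq: "Phi k xs = Phi k ys"
    for xs ys
  proof -
    let ?F = "\<lambda>c. part_add (flat_part k c) (strips k c)"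
    have "is_partition (?F (conjugate zs))" for zs
      by (intro part_add_parts(1) is_partition_flat_part is_partition_strips is_partition_conjugate k)
    \<comment> \<open>Conjugation is an involution, so it undoes the last step of \<open>Phi\<close>
      and exposes \<alpha>.\<close>
    then have "conjugate (Phi k zs) = ?F (conjugate zs)" for zs
      unfolding Phi_def Let_def by (rule conjugate_conjugate)
    then have "?F (conjugate xs) = ?F (conjugate ys)"
      using eq by metis
    then have "conjugate xs = conjugate ys"
      by (rule flat_strips_determine[OF is_partition_conjugate is_partition_conjugate k])
    moreover have "is_partition xs" "is_partition ys"
      using xs ys by (simp_all add: A_set_def)
    ultimately show "xs = ys"
      by (metis conjugate_conjugate)
  qed
  obtain xs where xs: "xs \<in> A_set k" "Phi k xs = b"
    using ex_Phi_preimage[OF k b] by blast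
  show "\<exists>!xs. xs \<in> A_set k \<and> Phi k xs = b"
  proof (rule ex1I[of _ xs])
    show "ys = xs" if "ys \<in> A_set k \<and> Phi k ys = b" for ys
      using inj[of ys xs] that xs by simp
  qed (use xs in simp)
qed

end
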